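(* Let $\mathcal{M}$ be a cartesian category, regarded as acting on itself via the cartesian product. Then the category $[\mathcal{M},\mathcal{M}]_{\mathsf{cst}}$ of costrong endofunctors on $\mathcal{M}$ and costrong natural transformations is isomorphic to the category $[\mathcal{M},\mathcal{M}]\downarrow\mathsf{id}_{\mathcal{M}}$ of copointed endofunctors on $\mathcal{M}$ and copointed natural transformations.
   Context: A costrong endofunctor on $\mathcal{M}$ (for the action of $(\mathcal{M},\times,\mathbb{1})$ on itself by $\times$) is a functor $F:\mathcal{M}\to\mathcal{M}$ with a natural transformation $\mathsf{cst}_{M,X}:F(M\times X)\to M\times F(X)$ such that (writing associativity and unit isomorphisms of $\times$ unlabelled) $\mathsf{cst}_{M\times N,X}\circ F(\cong)=\cong\circ(\mathsf{id}_M\times\mathsf{cst}_{N,X})\circ\mathsf{cst}_{M,N\times X}$ as maps $F(M\times(N\times X))\to(M\times N)\times F(X)$, and $F(\mathbb{1}\times X)\xrightarrow{\mathsf{cst}}\mathbb{1}\times F(X)\cong F(X)$ equals $F(\mathbb{1}\times X\cong X)$. A costrong natural transformation $\alpha:(F,\mathsf{cst})\to(G,\mathsf{cst})$ is a natural transformation $\alpha:F\to G$ with $\mathsf{cst}^G_{M,X}\circ\alpha_{M\times X}=(\mathsf{id}_M\times\alpha_X)\circ\mathsf{cst}^F_{M,X}$. A copointed endofunctor is a pair $(F,\epsilon)$ with $F:\mathcal{M}\to\mathcal{M}$ a functor and $\epsilon:F\to\mathsf{id}_{\mathcal{M}}$ a natural transformation; a copointed natural transformation $\alpha:(F,\epsilon)\to(G,\epsilon')$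 is a natural transformation $\alpha:F\to G$ with $\epsilon'\circ\alpha=\epsilon$. *)

theory Defs
  imports Main "HOL-Library.FuncSet"
begin

section \<open>Categories, functors, natural transformations\<close>

record ('o, 'a) cat_data =
  Obj :: "'o set"
  Arr :: "'a set"
  Dom :: "'a \<Rightarrow> 'o"
  Cod :: "'a \<Rightarrow> 'o"
  Id  :: "'o \<Rightarrow> 'a"
  Comp :: "'a \<Rightarrow> 'a \<Rightarrow> 'a"  (infixr "\<cdot>\<index>" 70)

definition hom :: "('o, 'a, 'x) cat_data_scheme \<Rightarrow> 'o \<Rightarrow> 'o \<Rightarrow> 'a set" where
  "hom C X Y = {f \<in> Arr C. Dom C f = X \<and> Cod C f = Y}"

locale category =
  fixes C :: "('o, 'a, 'x) cat_data_scheme" (structure)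
  assumes Dom_in_Obj: "f \<in> Arr C \<Longrightarrow> Dom C f \<in> Obj C"
    and Cod_in_Obj: "f \<in> Arr C \<Longrightarrow> Cod C f \<in> Obj C"
    and Id_in_hom: "X \<in> Obj C \<Longrightarrow> Id C X \<in> hom C X X"
    and Comp_in_hom: "\<lbrakk>f \<in> hom C X Y; g \<in> hom C Y Z\<rbrakk> \<Longrightarrow> g \<cdot> f \<in> hom C X Z"
    and Comp_Id: "f \<in> hom C X Y \<Longrightarrow> f \<cdot> Id C X = f"
    and Id_Comp: "f \<in> hom C X Y \<Longrightarrow> Id C Y \<cdot> f = f"
    and Comp_assoc: "\<lbrakk>f \<in> hom C W X; g \<in> hom C X Y; h \<in> hom C Y Z\<rbrakk>
                      \<Longrightarrow> (h \<cdot> g) \<cdot> f = h \<cdot> (g \<cdot> f)"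

record ('o, 'a, 'p, 'b) functor_data =
  FObj :: "'o \<Rightarrow> 'p"
  FArr :: "'a \<Rightarrow> 'b"

text \<open>
  Functors, natural transformations and costrengths are total HOL functions that are
  \<open>undefined\<close> outside their domain of definition, so that equality in HOL is the
  intended equality of functors and transformations.
\<close>

locale is_functor = source: category C + target: category D
  for C :: "('o, 'a, 'x) cat_data_scheme"
    and D :: "('p, 'b, 'y) cat_data_scheme" +
  fixes F :: "('o, 'a, 'p, 'b) functor_data"
  assumes FObj_in: "FObj F \<in> Obj C \<rightarrow>\<^sub>E Obj D"
    and FArr_ext: "FArr F \<in> extensional (Arr C)"
    and FArr_hom: "f \<in> hom C X Y \<Longrightarrow> FArr F f \<in> hom D (FObj F X) (FObj F Y)"
    and FArr_Id: "X \<in> Obj C \<Longrightarrow> FArr F (Id C X) = Id D (FObj F X)"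
    and FArr_Comp: "\<lbrakk>f \<in> hom C X Y; g \<in> hom C Y Z\<rbrakk>
                     \<Longrightarrow> FArr F (g \<cdot>\<^bsub>C\<^esub> f) = FArr F g \<cdot>\<^bsub>D\<^esub> FArr F f"

definition functor_id :: "('o, 'a, 'x) cat_data_scheme \<Rightarrow> ('o, 'a, 'o, 'a) functor_data" where
  "functor_id C = \<lparr>FObj = (\<lambda>X\<in>Obj C. X), FArr = (\<lambda>f\<in>Arr C. f)\<rparr>"

definition functor_comp ::
  "('o, 'a, 'x) cat_data_scheme \<Rightarrow> ('p, 'b, 'q, 'c) functor_data
    \<Rightarrow> ('o, 'a, 'p, 'b) functor_data \<Rightarrow> ('o, 'a, 'q, 'c) functor_data" where
  "functor_comp C G F =
     \<lparr>FObj = (\<lambda>X\<in>Obj C. FObj G (FObj F X)), FArr = (\<lambda>f\<in>Arr C. FArr G (FArr F f))\<rparr>"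

definition isomorphic_categories ::
  "('o, 'a, 'x) cat_data_scheme \<Rightarrow> ('p, 'b, 'y) cat_data_scheme \<Rightarrow> bool" where
  "isomorphic_categories C D \<longleftrightarrow>
     (\<exists>F G. is_functor C D F \<and> is_functor D C G \<and>
        functor_comp C G F = functor_id C \<and> functor_comp D F G = functor_id D)"

locale nat_trans = F: is_functor C D F + G: is_functor C D G
  for C :: "('o, 'a, 'x) cat_data_scheme"
    and D :: "('p, 'b, 'y) cat_data_scheme"
    and F :: "('o, 'a, 'p, 'b) functor_data"
    and G :: "('o, 'a, 'p, 'b) functor_data" +
  fixes \<alpha> :: "'o \<Rightarrow> 'b"
  assumes component_ext: "\<alpha> \<in> extensional (Obj C)"
    and component_hom: "X \<in> Obj C \<Longrightarrow> \<alpha> X \<in> hom D (FObj F X) (FObj G X)"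
    and naturality: "f \<in> hom C X Y \<Longrightarrow> \<alpha> Y \<cdot>\<^bsub>D\<^esub> FArr F f = FArr G f \<cdot>\<^bsub>D\<^esub> \<alpha> X"

definition nt_id ::
  "('o, 'a, 'x) cat_data_scheme \<Rightarrow> ('p, 'b, 'y) cat_data_scheme
    \<Rightarrow> ('o, 'a, 'p, 'b) functor_data \<Rightarrow> 'o \<Rightarrow> 'b" where
  "nt_id C D F = (\<lambda>X\<in>Obj C. Id D (FObj F X))"

definition nt_comp ::
  "('o, 'a, 'x) cat_data_scheme \<Rightarrow> ('p, 'b, 'y) cat_data_scheme
    \<Rightarrow> ('o \<Rightarrow> 'b) \<Rightarrow> ('o \<Rightarrow> 'b) \<Rightarrow> 'o \<Rightarrow> 'b" where
  "nt_comp C D \<beta> \<alpha> = (\<lambda>X\<in>Obj C. \<beta> X \<cdot>\<^bsub>D\<^esub> \<alpha> X)"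


section \<open>Cartesian categories\<close>

definition is_terminal :: "('o, 'a, 'x) cat_data_scheme \<Rightarrow> 'o \<Rightarrow> bool" where
  "is_terminal C T \<longleftrightarrow> T \<in> Obj C \<and> (\<forall>X\<in>Obj C. \<exists>!f. f \<in> hom C X T)"

definition is_product ::
  "('o, 'a, 'x) cat_data_scheme \<Rightarrow> 'o \<Rightarrow> 'o \<Rightarrow> 'o \<Rightarrow> 'a \<Rightarrow> 'a \<Rightarrow> bool" where
  "is_product C X Y P p q \<longleftrightarrow>
     P \<in> Obj C \<and> p \<in> hom C P X \<and> q \<in> hom C P Y \<and>
     (\<forall>Z\<in>Obj C. \<forall>f\<in>hom C Z X. \<forall>g\<in>hom C Z Y.
        \<exists>!h. h \<in> hom C Z P \<and> p \<cdot>\<^bsub>C\<^esub> h = f \<and> q \<cdot>\<^bsub>C\<^esub> h = g)"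

record ('o, 'a) cart_data = "('o, 'a) cat_data" +
  One :: "'o"
  Prod :: "'o \<Rightarrow> 'o \<Rightarrow> 'o"
  Pr1 :: "'o \<Rightarrow> 'o \<Rightarrow> 'a"
  Pr2 :: "'o \<Rightarrow> 'o \<Rightarrow> 'a"

locale cartesian_category = category M
  for M :: "('o, 'a, 'x) cart_data_scheme" (structure) +
  assumes One_terminal: "is_terminal M (One M)"
    and Prod_product: "\<lbrakk>X \<in> Obj M; Y \<in> Obj M\<rbrakk>
                        \<Longrightarrow> is_product M X Y (Prod M X Y) (Pr1 M X Y) (Pr2 M X Y)"

definition tuple :: "('o, 'a, 'x) cart_data_scheme \<Rightarrow> 'a \<Rightarrow> 'a \<Rightarrow> 'a" where
  "tuple M f g =
     (THE h. h \<in> hom M (Dom M f) (Prod M (Cod M f) (Cod M g)) \<and>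
        Pr1 M (Cod M f) (Cod M g) \<cdot>\<^bsub>M\<^esub> h = f \<and> Pr2 M (Cod M f) (Cod M g) \<cdot>\<^bsub>M\<^esub> h = g)"

definition prod_arr :: "('o, 'a, 'x) cart_data_scheme \<Rightarrow> 'a \<Rightarrow> 'a \<Rightarrow> 'a" where
  "prod_arr M f g =
     tuple M (f \<cdot>\<^bsub>M\<^esub> Pr1 M (Dom M f) (Dom M g)) (g \<cdot>\<^bsub>M\<^esub> Pr2 M (Dom M f) (Dom M g))"

text \<open>The canonical isomorphism \<open>X \<times> (Y \<times> Z) \<rightarrow> (X \<times> Y) \<times> Z\<close>.\<close>

definition assoc_iso :: "('o, 'a, 'x) cart_data_scheme \<Rightarrow> 'o \<Rightarrow> 'o \<Rightarrow> 'o \<Rightarrow> 'a" where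
  "assoc_iso M X Y Z =
     tuple M
       (tuple M (Pr1 M X (Prod M Y Z)) (Pr1 M Y Z \<cdot>\<^bsub>M\<^esub> Pr2 M X (Prod M Y Z)))
       (Pr2 M Y Z \<cdot>\<^bsub>M\<^esub> Pr2 M X (Prod M Y Z))"

text \<open>The canonical isomorphism \<open>1 \<times> X \<rightarrow> X\<close>.\<close>

definition unit_iso :: "('o, 'a, 'x) cart_data_scheme \<Rightarrow> 'o \<Rightarrow> 'a" where
  "unit_iso M X = Pr2 M (One M) X"


section \<open>Costrong endofunctors\<close>

type_synonym ('o, 'a) costrong_functor = "('o, 'a, 'o, 'a) functor_data \<times> ('o \<times> 'o \<Rightarrow> 'a)"

locale costrong_endofunctor = cartesian_category M + is_functor M M F
  for M :: "('o, 'a, 'x) cart_data_scheme"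
    and F :: "('o, 'a, 'o, 'a) functor_data" +
  fixes cst :: "'o \<times> 'o \<Rightarrow> 'a"
  assumes cst_ext: "cst \<in> extensional (Obj M \<times> Obj M)"
    and cst_hom: "\<lbrakk>A \<in> Obj M; X \<in> Obj M\<rbrakk>
          \<Longrightarrow> cst (A, X) \<in> hom M (FObj F (Prod M A X)) (Prod M A (FObj F X))"
    and cst_natural: "\<lbrakk>f \<in> hom M A B; g \<in> hom M X Y\<rbrakk>
          \<Longrightarrow> cst (B, Y) \<cdot>\<^bsub>M\<^esub> FArr F (prod_arr M f g)
            = prod_arr M f (FArr F g) \<cdot>\<^bsub>M\<^esub> cst (A, X)"
    and cst_assoc: "\<lbrakk>A \<in> Obj M; B \<in> Obj M; X \<in> Obj M\<rbrakk>
          \<Longrightarrow> cst (Prod M A B, X) \<cdot>\<^bsub>M\<^esub> FArr F (assoc_iso M A B X)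
            = assoc_iso M A B (FObj F X) \<cdot>\<^bsub>M\<^esub>
                (prod_arr M (Id M A) (cst (B, X)) \<cdot>\<^bsub>M\<^esub> cst (A, Prod M B X))"
    and cst_unit: "X \<in> Obj M
          \<Longrightarrow> unit_iso M (FObj F X) \<cdot>\<^bsub>M\<^esub> cst (One M, X) = FArr F (unit_iso M X)"

definition costrong_nat_trans ::
  "('o, 'a, 'x) cart_data_scheme \<Rightarrow> ('o, 'a) costrong_functor \<Rightarrow> ('o, 'a) costrong_functor
    \<Rightarrow> ('o \<Rightarrow> 'a) \<Rightarrow> bool" where
  "costrong_nat_trans M S T \<alpha> \<longleftrightarrow>
     nat_trans M M (fst S) (fst T) \<alpha> \<and>
     (\<forall>A\<in>Obj M. \<forall>X\<in>Obj M.
        snd T (A, X) \<cdot>\<^bsub>M\<^esub> \<alpha> (Prod M A X) = prod_arr M (Id M A) (\<alpha> X) \<cdot>\<^bsub>M\<^esub> snd S (A, X))"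

text \<open>An arrow of the two categories below is a triple of source, target and transformation.\<close>

definition costrong_category ::
  "('o, 'a, 'x) cart_data_scheme
    \<Rightarrow> (('o, 'a) costrong_functor,
        ('o, 'a) costrong_functor \<times> ('o, 'a) costrong_functor \<times> ('o \<Rightarrow> 'a)) cat_data" where
  "costrong_category M =
     \<lparr>Obj = {(F, cst). costrong_endofunctor M F cst},
      Arr = {(S, T, \<alpha>). costrong_endofunctor M (fst S) (snd S) \<and>
               costrong_endofunctor M (fst T) (snd T) \<and> costrong_nat_trans M S T \<alpha>},
      Dom = (\<lambda>(S, T, \<alpha>). S),
      Cod = (\<lambda>(S, T, \<alpha>). T),
      Id = (\<lambda>S. (S, S, nt_id M M (fst S))),
      Comp = (\<lambda>(S', T', \<beta>) (S, T, \<alpha>). (S, T', nt_comp M M \<beta> \<alpha>))\<rparr>"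


section \<open>Copointed endofunctors\<close>

type_synonym ('o, 'a) copointed_functor = "('o, 'a, 'o, 'a) functor_data \<times> ('o \<Rightarrow> 'a)"

definition copointed_endofunctor ::
  "('o, 'a, 'x) cat_data_scheme \<Rightarrow> ('o, 'a, 'o, 'a) functor_data \<Rightarrow> ('o \<Rightarrow> 'a) \<Rightarrow> bool" where
  "copointed_endofunctor M F \<epsilon> \<longleftrightarrow> nat_trans M M F (functor_id M) \<epsilon>"

definition copointed_nat_trans ::
  "('o, 'a, 'x) cat_data_scheme \<Rightarrow> ('o, 'a) copointed_functor \<Rightarrow> ('o, 'a) copointed_functor
    \<Rightarrow> ('o \<Rightarrow> 'a) \<Rightarrow> bool" where
  "copointed_nat_trans M S T \<alpha> \<longleftrightarrow>
     nat_trans M M (fst S) (fst T) \<alpha> \<and> nt_comp M M (snd T) \<alpha> = snd S"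

definition copointed_category ::
  "('o, 'a, 'x) cat_data_scheme
    \<Rightarrow> (('o, 'a) copointed_functor,
        ('o, 'a) copointed_functor \<times> ('o, 'a) copointed_functor \<times> ('o \<Rightarrow> 'a)) cat_data" where
  "copointed_category M =
     \<lparr>Obj = {(F, \<epsilon>). copointed_endofunctor M F \<epsilon>},
      Arr = {(S, T, \<alpha>). copointed_endofunctor M (fst S) (snd S) \<and>
               copointed_endofunctor M (fst T) (snd T) \<and> copointed_nat_trans M S T \<alpha>},
      Dom = (\<lambda>(S, T, \<alpha>). S),
      Cod = (\<lambda>(S, T, \<alpha>). T),
      Id = (\<lambda>S. (S, S, nt_id M M (fst S))),
      Comp = (\<lambda>(S', T', \<beta>) (S, T, \<alpha>). (S, T', nt_comp M M \<beta> \<alpha>))\<rparr>"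

end

theory Submission
  imports Defs
begin

text \<open>
  Naturality of a costrength along \<open>A \<rightarrow> 1\<close> together with the unit law forces
  \<open>\<pi>\<^sub>2 \<circ> cst = F \<pi>\<^sub>2\<close>, and naturality along \<open>X \<rightarrow> 1\<close> forces \<open>\<pi>\<^sub>1 \<circ> cst = \<epsilon> \<circ> F \<pi>\<^sub>1\<close>, where
  \<open>\<epsilon>\<^sub>X : F X \<cong> F (X \<times> 1) \<rightarrow> X \<times> F 1 \<rightarrow> X\<close>. So a costrength is the same thing as a copoint
  \<open>\<epsilon>\<close>, recovered as \<open>cst = \<langle>\<epsilon> \<circ> F \<pi>\<^sub>1, F \<pi>\<^sub>2\<rangle>\<close>. A natural transformation respects the second
  component automatically, and respects the first exactly when it respects the copoints.
\<close>

section \<open>Categories of endofunctors with structure\<close>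

text \<open>Both categories of the theorem are instances: they differ only in the structure
  \<open>P\<close> on a functor and in the compatibility \<open>H\<close> demanded of a
  transformation. Category laws and functoriality are thus proved once.\<close>

definition structured_category ::
  "('o, 'a, 'x) cat_data_scheme \<Rightarrow> (('o, 'a, 'o, 'a) functor_data \<Rightarrow> 's \<Rightarrow> bool)
    \<Rightarrow> (('o, 'a, 'o, 'a) functor_data \<times> 's \<Rightarrow> ('o, 'a, 'o, 'a) functor_data \<times> 's
          \<Rightarrow> ('o \<Rightarrow> 'a) \<Rightarrow> bool)
    \<Rightarrow> (('o, 'a, 'o, 'a) functor_data \<times> 's,
        (('o, 'a, 'o, 'a) functor_data \<times> 's) \<times> (('o, 'a, 'o, 'a) functor_data \<times> 's)
          \<times> ('o \<Rightarrow> 'a)) cat_data" where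
  "structured_category M P H =
     \<lparr>Obj = {(F, s). P F s},
      Arr = {(S, T, \<alpha>). P (fst S) (snd S) \<and> P (fst T) (snd T) \<and> H S T \<alpha>},
      Dom = (\<lambda>(S, T, \<alpha>). S),
      Cod = (\<lambda>(S, T, \<alpha>). T),
      Id = (\<lambda>S. (S, S, nt_id M M (fst S))),
      Comp = (\<lambda>(S', T', \<beta>) (S, T, \<alpha>). (S, T', nt_comp M M \<beta> \<alpha>))\<rparr>"

lemma costrong_category_eq:
  "costrong_category M = structured_category M (costrong_endofunctor M) (costrong_nat_trans M)"
  by (simp add: costrong_category_def structured_category_def)

lemma copointed_category_eq:
  "copointed_category M = structured_category M (copointed_endofunctor M) (copointed_nat_trans M)"
  by (simp add: copointed_category_def structured_category_def)

text \<open>The category axioms with equations on \<open>Dom\<close> and \<open>Cod\<close> as side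
  conditions in place of \<open>hom\<close> membership, so that intermediate objects are computed by
  rewriting instead of guessed.\<close>

lemma (in category) Arr_simps:
  shows "X \<in> Obj C \<Longrightarrow> Id C X \<in> Arr C"
    and "X \<in> Obj C \<Longrightarrow> Dom C (Id C X) = X"
    and "X \<in> Obj C \<Longrightarrow> Cod C (Id C X) = X"
    and "f \<in> Arr C \<Longrightarrow> g \<in> Arr C \<Longrightarrow> Dom C g = Cod C f \<Longrightarrow> g \<cdot> f \<in> Arr C"
    and "f \<in> Arr C \<Longrightarrow> g \<in> Arr C \<Longrightarrow> Dom C g = Cod C f \<Longrightarrow> Dom C (g \<cdot> f) = Dom C f"
    and "f \<in> Arr C \<Longrightarrow> g \<in> Arr C \<Longrightarrow> Dom C g = Cod C f \<Longrightarrow> Cod C (g \<cdot> f) = Cod C g"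
    and "f \<in> Arr C \<Longrightarrow> Dom C f = X \<Longrightarrow> f \<cdot> Id C X = f"
    and "f \<in> Arr C \<Longrightarrow> Cod C f = X \<Longrightarrow> Id C X \<cdot> f = f"
    and "f \<in> Arr C \<Longrightarrow> g \<in> Arr C \<Longrightarrow> h \<in> Arr C \<Longrightarrow> Dom C g = Cod C f \<Longrightarrow> Dom C h = Cod C g
          \<Longrightarrow> (h \<cdot> g) \<cdot> f = h \<cdot> (g \<cdot> f)"
    and "f \<in> Arr C \<Longrightarrow> Dom C f \<in> Obj C"
    and "f \<in> Arr C \<Longrightarrow> Cod C f \<in> Obj C"
  using Id_in_hom[of X] Comp_in_hom[of f "Dom C f" "Cod C f" g "Cod C g"]
    Comp_Id[of f "Dom C f" "Cod C f"] Id_Comp[of f "Dom C f" "Cod C f"]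
    Comp_assoc[of f "Dom C f" "Cod C f" g "Cod C g" h "Cod C h"] Dom_in_Obj[of f] Cod_in_Obj[of f]
  by (auto simp: hom_def)

section \<open>Identity and composite natural transformations\<close>

lemma (in nat_trans) nt_Id_Comp: "nt_comp C D (nt_id C D G) \<alpha> = \<alpha>"
  using component_ext
  by (auto simp: nt_comp_def nt_id_def fun_eq_iff extensional_def
      intro: F.target.Id_Comp component_hom)

lemma (in nat_trans) nt_Comp_Id: "nt_comp C D \<alpha> (nt_id C D F) = \<alpha>"
  using component_ext
  by (auto simp: nt_comp_def nt_id_def fun_eq_iff extensional_def
      intro: F.target.Comp_Id component_hom)

lemma (in is_functor) nat_trans_nt_id: "nat_trans C D F F (nt_id C D F)"
proof
  fix X assume "X \<in> Obj C"
  then show "nt_id C D F X \<in> hom D (FObj F X) (FObj F X)"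
    using FObj_in by (auto simp: nt_id_def intro: target.Id_in_hom)
next
  fix f X Y assume f: "f \<in> hom C X Y"
  then have "X \<in> Obj C" "Y \<in> Obj C"
    by (auto simp: hom_def source.Dom_in_Obj source.Cod_in_Obj)
  then show "nt_id C D F Y \<cdot>\<^bsub>D\<^esub> FArr F f = FArr F f \<cdot>\<^bsub>D\<^esub> nt_id C D F X"
    using FArr_hom[OF f] by (simp add: nt_id_def target.Id_Comp target.Comp_Id)
qed (simp add: nt_id_def)

lemma nat_trans_nt_comp:
  assumes "nat_trans C D F G \<alpha>" and "nat_trans C D G H \<beta>"
  shows "nat_trans C D F H (nt_comp C D \<beta> \<alpha>)"
proof -
  interpret a: nat_trans C D F G \<alpha> by fact
  interpret b: nat_trans C D G H \<beta> by fact
  show ?thesis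
  proof
    fix X assume "X \<in> Obj C"
    then show "nt_comp C D \<beta> \<alpha> X \<in> hom D (FObj F X) (FObj H X)"
      by (auto simp: nt_comp_def intro: a.F.target.Comp_in_hom a.component_hom b.component_hom)
  next
    fix f X Y assume f: "f \<in> hom C X Y"
    then have X: "X \<in> Obj C" and Y: "Y \<in> Obj C"
      by (auto simp: hom_def a.F.source.Dom_in_Obj a.F.source.Cod_in_Obj)
    show "nt_comp C D \<beta> \<alpha> Y \<cdot>\<^bsub>D\<^esub> FArr F f = FArr H f \<cdot>\<^bsub>D\<^esub> nt_comp C D \<beta> \<alpha> X"
      using X Y a.F.target.Comp_assoc[OF a.F.FArr_hom[OF f] a.component_hom[OF Y] b.component_hom[OF Y]]
        a.F.target.Comp_assoc[OF a.component_hom[OF X] a.G.FArr_hom[OF f] b.component_hom[OF Y]]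
        a.F.target.Comp_assoc[OF a.component_hom[OF X] b.component_hom[OF X] b.G.FArr_hom[OF f]]
        a.naturality[OF f] b.naturality[OF f]
      by (simp add: nt_comp_def)
  qed (simp add: nt_comp_def)
qed

lemma nt_comp_assoc:
  assumes "nat_trans C D F G \<alpha>" and "nat_trans C D G H \<beta>" and "nat_trans C D H K \<gamma>"
  shows "nt_comp C D (nt_comp C D \<gamma> \<beta>) \<alpha> = nt_comp C D \<gamma> (nt_comp C D \<beta> \<alpha>)"
proof -
  interpret a: nat_trans C D F G \<alpha> by fact
  interpret b: nat_trans C D G H \<beta> by fact
  interpret c: nat_trans C D H K \<gamma> by fact
  show ?thesis
    by (auto simp: nt_comp_def fun_eq_iff
        intro: a.F.target.Comp_assoc a.component_hom b.component_hom c.component_hom)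
qed

text \<open>Unit and associativity laws are inherited from natural transformations; what remains is
  that \<open>H\<close> contains identities and is closed under composition.\<close>

lemma category_structured_category:
  assumes nat: "\<And>F s G t \<alpha>. H (F, s) (G, t) \<alpha> \<Longrightarrow> nat_trans M M F G \<alpha>"
    and ident: "\<And>F s. P F s \<Longrightarrow> H (F, s) (F, s) (nt_id M M F)"
    and comp: "\<And>F s G t K u \<alpha> \<beta>. \<lbrakk>P F s; P G t; P K u; H (F, s) (G, t) \<alpha>; H (G, t) (K, u) \<beta>\<rbrakk>
                 \<Longrightarrow> H (F, s) (K, u) (nt_comp M M \<beta> \<alpha>)"
  shows "category (structured_category M P H)"
proof
qed (auto simp: structured_category_def hom_def ident
    intro: comp nat_trans.nt_Comp_Id[OF nat] nat_trans.nt_Id_Comp[OF nat]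
      nt_comp_assoc[OF nat nat nat])

text \<open>Only the structure changes, along \<open>\<phi>\<close>; the underlying functor and
  transformation stay fixed, so identities and composites are preserved strictly.\<close>

lemma is_functor_structured_category:
  assumes "category (structured_category M P H)" and "category (structured_category M P' H')"
    and P: "\<And>F s. P F s \<Longrightarrow> P' F (\<phi> F s)"
    and H: "\<And>F s G t \<alpha>. \<lbrakk>P F s; P G t; H (F, s) (G, t) \<alpha>\<rbrakk> \<Longrightarrow> H' (F, \<phi> F s) (G, \<phi> G t) \<alpha>"
  shows "is_functor (structured_category M P H) (structured_category M P' H')
    \<lparr>FObj = (\<lambda>(F, s)\<in>Obj (structured_category M P H). (F, \<phi> F s)),
     FArr = (\<lambda>((F, s), (G, t), \<alpha>)\<in>Arr (structured_category M P H).
               ((F, \<phi> F s), (G, \<phi> G t), \<alpha>))\<rparr>"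
    (is "is_functor ?C ?D ?\<Phi>")
proof -
  interpret C: category ?C by fact
  interpret D: category ?D by fact
  show ?thesis
  proof
    fix f X Y g Z
    assume f: "f \<in> hom ?C X Y" and g: "g \<in> hom ?C Y Z"
    \<comment> \<open>The arrow map is \<open>undefined\<close> outside \<open>Arr\<close>, so the
      composite must be known to be an arrow.\<close>
    with C.Comp_in_hom[OF f g]
    show "FArr ?\<Phi> (g \<cdot>\<^bsub>?C\<^esub> f) = FArr ?\<Phi> g \<cdot>\<^bsub>?D\<^esub> FArr ?\<Phi> f"
      by (auto simp: structured_category_def hom_def)
  next
    fix X assume "X \<in> Obj ?C"
    then show "FArr ?\<Phi> (Id ?C X) = Id ?D (FObj ?\<Phi> X)"
      using C.Id_in_hom[of X] by (auto simp: structured_category_def hom_def)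
  qed (auto simp: structured_category_def hom_def intro: P H)
qed

text \<open>A bijection of structures over each fixed functor suffices if it matches the
  compatibility relations. The equivalence is stated along \<open>\<psi>\<close>; the direction
  along \<open>\<phi>\<close> follows since \<open>\<psi>\<close> undoes
  \<open>\<phi>\<close>.\<close>

lemma isomorphic_structured_categories:
  assumes C: "category (structured_category M P H)" and D: "category (structured_category M P' H')"
    and P: "\<And>F s. P F s \<Longrightarrow> P' F (\<phi> F s)"
    and P': "\<And>F s. P' F s \<Longrightarrow> P F (\<psi> F s)"
    and \<psi>\<phi>: "\<And>F s. P F s \<Longrightarrow> \<psi> F (\<phi> F s) = s"
    and \<phi>\<psi>: "\<And>F s. P' F s \<Longrightarrow> \<phi> F (\<psi> F s) = s"
    and H: "\<And>F s G t \<alpha>. P' F s \<Longrightarrow> P' G t \<Longrightarrow>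
              H (F, \<psi> F s) (G, \<psi> G t) \<alpha> \<longleftrightarrow> H' (F, s) (G, t) \<alpha>"
  shows "isomorphic_categories (structured_category M P H) (structured_category M P' H')"
proof -
  have H\<phi>: "H' (F, \<phi> F s) (G, \<phi> G t) \<alpha>" if "P F s" "P G t" "H (F, s) (G, t) \<alpha>" for F s G t \<alpha>
    using that H[OF P[OF that(1)] P[OF that(2)]] by (simp add: \<psi>\<phi>)
  have H\<psi>: "H (F, \<psi> F s) (G, \<psi> G t) \<alpha>" if "P' F s" "P' G t" "H' (F, s) (G, t) \<alpha>" for F s G t \<alpha>
    using that H by simp
  show ?thesis
    unfolding isomorphic_categories_def
    \<comment> \<open>Resolution with the functoriality lemma instantiates the two existential
      witnesses.\<close>
    by (intro exI conjI, rule is_functor_structured_category[OF C D P H\<phi>], assumption+,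
        rule is_functor_structured_category[OF D C P' H\<psi>], assumption+)
      (auto simp: functor_comp_def functor_id_def structured_category_def fun_eq_iff
        P P' \<psi>\<phi> \<phi>\<psi> H\<phi> H\<psi>)
qed

section \<open>Costrengths and copoints\<close>

definition bang :: "('o, 'a, 'x) cart_data_scheme \<Rightarrow> 'o \<Rightarrow> 'a" where
  "bang M X = (THE f. f \<in> hom M X (One M))"

context cartesian_category
begin

lemma One_in_Obj: "One M \<in> Obj M"
  using One_terminal by (simp add: is_terminal_def)

lemma bang_simps:
  assumes "X \<in> Obj M"
  shows "bang M X \<in> Arr M" "Dom M (bang M X) = X" "Cod M (bang M X) = One M"
  using theI'[of "\<lambda>f. f \<in> hom M X (One M)"] One_terminal assms
  by (auto simp: is_terminal_def bang_def hom_def)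

lemma bang_Comp:
  assumes "f \<in> Arr M" and "Cod M f = X"
  shows "bang M X \<cdot> f = bang M (Dom M f)"
  using One_terminal bang_simps[of X] bang_simps[of "Dom M f"] assms Arr_simps(4-6,10,11)[of f]
  by (auto simp: is_terminal_def hom_def)

lemma Prod_simps:
  assumes "X \<in> Obj M" and "Y \<in> Obj M"
  shows "Prod M X Y \<in> Obj M" 
    "Pr1 M X Y \<in> Arr M" "Dom M (Pr1 M X Y) = Prod M X Y" "Cod M (Pr1 M X Y) = X"
    "Pr2 M X Y \<in> Arr M" "Dom M (Pr2 M X Y) = Prod M X Y" "Cod M (Pr2 M X Y) = Y"
  using Prod_product[OF assms] by (auto simp: is_product_def hom_def)

lemma tuple_simps:
  assumes "f \<in> Arr M" and "g \<in> Arr M" and "Dom M f = Dom M g"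
  shows "tuple M f g \<in> Arr M" 
    and "Dom M (tuple M f g) = Dom M g"
    and "Cod M (tuple M f g) = Prod M (Cod M f) (Cod M g)"
    and "Cod M f = X \<Longrightarrow> Cod M g = Y \<Longrightarrow> Pr1 M X Y \<cdot> tuple M f g = f"
    and "Cod M f = X \<Longrightarrow> Cod M g = Y \<Longrightarrow> Pr2 M X Y \<cdot> tuple M f g = g"
proof -
  have "\<exists>!h. h \<in> hom M (Dom M f) (Prod M (Cod M f) (Cod M g)) \<and>
        Pr1 M (Cod M f) (Cod M g) \<cdot> h = f \<and> Pr2 M (Cod M f) (Cod M g) \<cdot> h = g"
    using Prod_product[of "Cod M f" "Cod M g"] assms Arr_simps(10,11)[of f] Arr_simps(10,11)[of g]
    by (simp add: is_product_def hom_def)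
  from theI'[OF this] assms show "tuple M f g \<in> Arr M" 
    and "Dom M (tuple M f g) = Dom M g"
    and "Cod M (tuple M f g) = Prod M (Cod M f) (Cod M g)"
    and "Cod M f = X \<Longrightarrow> Cod M g = Y \<Longrightarrow> Pr1 M X Y \<cdot> tuple M f g = f"
    and "Cod M f = X \<Longrightarrow> Cod M g = Y \<Longrightarrow> Pr2 M X Y \<cdot> tuple M f g = g"
    by (auto simp: tuple_def hom_def)
qed

text \<open>The projections are jointly monic: both arrows solve the universal problem posed by the
  two projections of \<open>f\<close>.\<close>

lemma eq_into_ProdI:
  assumes "X \<in> Obj M" and "Y \<in> Obj M"
    and "f \<in> Arr M" and "g \<in> Arr M" and "Dom M f = Dom M g"
    and "Cod M f = Prod M X Y" and "Cod M g = Prod M X Y"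
    and "Pr1 M X Y \<cdot> f = Pr1 M X Y \<cdot> g" and "Pr2 M X Y \<cdot> f = Pr2 M X Y \<cdot> g"
  shows "f = g"
proof -
  have "\<exists>!h. h \<in> hom M (Dom M f) (Prod M X Y) \<and>
        Pr1 M X Y \<cdot> h = Pr1 M X Y \<cdot> f \<and> Pr2 M X Y \<cdot> h = Pr2 M X Y \<cdot> f"
    using Prod_product[OF assms(1,2)] assms(3-7) Arr_simps(4-6,10)[of f] Prod_simps[OF assms(1,2)]
    by (simp add: is_product_def hom_def)
  then show ?thesis using assms by (auto simp: hom_def)
qed

lemma tuple_Comp:
  assumes "f \<in> Arr M" and "g \<in> Arr M" and "Dom M f = Dom M g" and "h \<in> Arr M" and "Cod M h = Dom M g"
  shows "tuple M f g \<cdot> h = tuple M (f \<cdot> h) (g \<cdot> h)"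
  \<comment> \<open>Associating to the left lets each projection meet the tuple it cancels.\<close>
  by (rule eq_into_ProdI[of "Cod M f" "Cod M g"])
    (use assms in \<open>simp_all add: Arr_simps tuple_simps Prod_simps flip: Arr_simps(9)\<close>)

lemma Pr_tuple_Comp:
  assumes "f \<in> Arr M" and "g \<in> Arr M" and "Dom M f = Dom M g" and "h \<in> Arr M" and "Cod M h = Dom M g"
    and "Cod M f = X" and "Cod M g = Y"
  shows "Pr1 M X Y \<cdot> (tuple M f g \<cdot> h) = f \<cdot> h" and "Pr2 M X Y \<cdot> (tuple M f g \<cdot> h) = g \<cdot> h"
  using assms by (auto simp: tuple_Comp Arr_simps tuple_simps)

text \<open>A rewriting system for finite products: composites associate to the right, composition
  moves inside tuples, projections cancel tuples.\<close>

lemmas cart_simps = Arr_simps One_in_Obj bang_simps bang_Comp Prod_simps tuple_simps Pr_tuple_Comp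
  prod_arr_def assoc_iso_def unit_iso_def tuple_Comp

end

text \<open>The tuple of \<open>Id M X\<close> and \<open>bang M X\<close> is the inverse of the
  first projection X x 1 -> X.\<close>

definition counit_of_costrength ::
  "('o, 'a, 'x) cart_data_scheme \<Rightarrow> ('o, 'a, 'o, 'a) functor_data \<Rightarrow> ('o \<times> 'o \<Rightarrow> 'a) \<Rightarrow> 'o \<Rightarrow> 'a"
where
  "counit_of_costrength M F cst =
     (\<lambda>X\<in>Obj M. Pr1 M X (FObj F (One M)) \<cdot>\<^bsub>M\<^esub>
        (cst (X, One M) \<cdot>\<^bsub>M\<^esub> FArr F (tuple M (Id M X) (bang M X))))"

definition costrength_of_counit ::
  "('o, 'a, 'x) cart_data_scheme \<Rightarrow> ('o, 'a, 'o, 'a) functor_data \<Rightarrow> ('o \<Rightarrow> 'a) \<Rightarrow> 'o \<times> 'o \<Rightarrow> 'a"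
where
  "costrength_of_counit M F \<epsilon> =
     (\<lambda>(A, X)\<in>Obj M \<times> Obj M. tuple M (\<epsilon> A \<cdot>\<^bsub>M\<^esub> FArr F (Pr1 M A X)) (FArr F (Pr2 M A X)))"

locale cartesian_endofunctor = cartesian_category M + is_functor M M F
  for M :: "('o, 'a, 'x) cart_data_scheme" (structure)
    and F :: "('o, 'a, 'o, 'a) functor_data"
begin

lemma FObj_simp: "X \<in> Obj M \<Longrightarrow> FObj F X \<in> Obj M"
  using FObj_in by auto

lemma FArr_simps:
  assumes "f \<in> Arr M"
  shows "FArr F f \<in> Arr M" "Dom M (FArr F f) = FObj F (Dom M f)" "Cod M (FArr F f) = FObj F (Cod M f)"
  using FArr_hom[of f "Dom M f" "Cod M f"] assms by (auto simp: hom_def)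

text \<open>Oriented to collect images under \<open>F\<close> into one, so that the arrow under
  \<open>F\<close> can be simplified; the second clause handles a further factor in a
  right-associated composite.\<close>

lemma FArr_Comp_FArr:
  assumes "f \<in> Arr M" and "g \<in> Arr M" and "Dom M g = Cod M f"
  shows "FArr F g \<cdot> FArr F f = FArr F (g \<cdot> f)"
    and "h \<in> Arr M \<Longrightarrow> Cod M h = FObj F (Dom M f) \<Longrightarrow>
          FArr F g \<cdot> (FArr F f \<cdot> h) = FArr F (g \<cdot> f) \<cdot> h"
proof -
  show *: "FArr F g \<cdot> FArr F f = FArr F (g \<cdot> f)"
    using FArr_Comp[of f "Dom M f" "Cod M f" g "Cod M g"] assms by (simp add: hom_def)
  show "FArr F g \<cdot> (FArr F f \<cdot> h) = FArr F (g \<cdot> f) \<cdot> h"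
    if "h \<in> Arr M" "Cod M h = FObj F (Dom M f)"
    using that assms by (simp add: Arr_simps FArr_simps flip: Arr_simps(9) *)
qed

lemmas endo_simps = cart_simps FObj_simp FArr_simps FArr_Comp_FArr FArr_Id

end

lemma (in costrong_endofunctor) is_cartesian_endofunctor: "cartesian_endofunctor M F"
  by unfold_locales

sublocale costrong_endofunctor \<subseteq> cartesian_endofunctor M F
  by (rule is_cartesian_endofunctor)

section \<open>From costrengths to copoints\<close>

context costrong_endofunctor
begin

lemma cst_simps:
  assumes "A \<in> Obj M" and "X \<in> Obj M"
  shows "cst (A, X) \<in> Arr M" "Dom M (cst (A, X)) = FObj F (Prod M A X)"
    "Cod M (cst (A, X)) = Prod M A (FObj F X)"
  using cst_hom[OF assms] by (auto simp: hom_def)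

lemma Pr2_cst:
  assumes "A \<in> Obj M" and "X \<in> Obj M"
  shows "Pr2 M A (FObj F X) \<cdot>\<^bsub>M\<^esub> cst (A, X) = FArr F (Pr2 M A X)"
proof -
  \<comment> \<open>Postcomposing with ! x id leaves the second component alone. Writing the
    identity as \<open>FArr F (Id M X)\<close> exhibits the right-hand side of
    \<open>cst_natural\<close>.\<close>
  have "Pr2 M A (FObj F X) \<cdot>\<^bsub>M\<^esub> cst (A, X)
      = Pr2 M (One M) (FObj F X) \<cdot>\<^bsub>M\<^esub>
          (prod_arr M (bang M A) (FArr F (Id M X)) \<cdot>\<^bsub>M\<^esub> cst (A, X))"
    using assms by (simp add: endo_simps cst_simps)
  also have "\<dots> = Pr2 M (One M) (FObj F X) \<cdot>\<^bsub>M\<^esub>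
      (cst (One M, X) \<cdot>\<^bsub>M\<^esub> FArr F (prod_arr M (bang M A) (Id M X)))"
    using assms by (subst cst_natural[symmetric]) (auto simp: hom_def endo_simps)
  also have "\<dots> = (unit_iso M (FObj F X) \<cdot>\<^bsub>M\<^esub> cst (One M, X)) \<cdot>\<^bsub>M\<^esub>
      FArr F (prod_arr M (bang M A) (Id M X))"
    using assms by (simp add: endo_simps cst_simps)
  also have "\<dots> = FArr F (Pr2 M A X)"
    unfolding cst_unit[OF assms(2)] using assms by (simp add: endo_simps)
  finally show ?thesis .
qed

lemma Pr1_cst:
  assumes "A \<in> Obj M" and "X \<in> Obj M"
  shows "Pr1 M A (FObj F X) \<cdot>\<^bsub>M\<^esub> cst (A, X)
    = counit_of_costrength M F cst A \<cdot>\<^bsub>M\<^esub> FArr F (Pr1 M A X)"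
proof -
  have "Pr1 M A (FObj F X) \<cdot>\<^bsub>M\<^esub> cst (A, X)
      = Pr1 M A (FObj F (One M)) \<cdot>\<^bsub>M\<^esub>
          (prod_arr M (Id M A) (FArr F (bang M X)) \<cdot>\<^bsub>M\<^esub> cst (A, X))"
    using assms by (simp add: endo_simps cst_simps)
  also have "\<dots> = Pr1 M A (FObj F (One M)) \<cdot>\<^bsub>M\<^esub>
      (cst (A, One M) \<cdot>\<^bsub>M\<^esub> FArr F (prod_arr M (Id M A) (bang M X)))"
    using assms by (subst cst_natural[symmetric]) (auto simp: hom_def endo_simps)
  \<comment> \<open>By uniqueness of arrows into \<open>One M\<close>, id x ! equals <id, !>
    composed with the first projection.\<close>
  also have "\<dots> = counit_of_costrength M F cst A \<cdot>\<^bsub>M\<^esub> FArr F (Pr1 M A X)"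
    using assms by (simp add: counit_of_costrength_def endo_simps cst_simps)
  finally show ?thesis .
qed

lemma counit_simps:
  assumes "X \<in> Obj M"
  shows "counit_of_costrength M F cst X \<in> Arr M"
    "Dom M (counit_of_costrength M F cst X) = FObj F X"
    "Cod M (counit_of_costrength M F cst X) = X"
  using assms by (simp_all add: counit_of_costrength_def endo_simps cst_simps)

lemma copointed_counit: "copointed_endofunctor M F (counit_of_costrength M F cst)"
  unfolding copointed_endofunctor_def
proof
  fix f X Y assume "f \<in> hom M X Y"
  then have f: "f \<in> Arr M" "X = Dom M f" "Y = Cod M f" by (auto simp: hom_def)
  \<comment> \<open>Both <id, !> after \<open>f\<close> and f x id after <id, !> equal <f, !>; this
    produces an arrow f x id along which \<open>cst\<close> is natural.\<close>
  have "counit_of_costrength M F cst Y \<cdot>\<^bsub>M\<^esub> FArr F f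
      = Pr1 M Y (FObj F (One M)) \<cdot>\<^bsub>M\<^esub> ((cst (Y, One M) \<cdot>\<^bsub>M\<^esub> FArr F (prod_arr M f (Id M (One M))))
          \<cdot>\<^bsub>M\<^esub> FArr F (tuple M (Id M X) (bang M X)))"
    using f by (simp add: counit_of_costrength_def endo_simps cst_simps)
  also have "cst (Y, One M) \<cdot>\<^bsub>M\<^esub> FArr F (prod_arr M f (Id M (One M)))
      = prod_arr M f (FArr F (Id M (One M))) \<cdot>\<^bsub>M\<^esub> cst (X, One M)"
    using f by (intro cst_natural) (auto simp: hom_def endo_simps)
  also have "Pr1 M Y (FObj F (One M)) \<cdot>\<^bsub>M\<^esub> (\<dots> \<cdot>\<^bsub>M\<^esub> FArr F (tuple M (Id M X) (bang M X)))
      = f \<cdot>\<^bsub>M\<^esub> counit_of_costrength M F cst X"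
    using f by (simp add: counit_of_costrength_def endo_simps cst_simps)
  finally show "counit_of_costrength M F cst Y \<cdot>\<^bsub>M\<^esub> FArr F f
      = FArr (functor_id M) f \<cdot>\<^bsub>M\<^esub> counit_of_costrength M F cst X"
    using f by (simp add: functor_id_def)
next
  show "counit_of_costrength M F cst \<in> extensional (Obj M)"
    by (simp add: counit_of_costrength_def)
qed (auto simp: functor_id_def hom_def endo_simps counit_simps)

text \<open>An arrow into a product is determined by its projections, which \<open>Pr1_cst\<close>
  and \<open>Pr2_cst\<close> compute.\<close>

lemma costrength_of_counit_of_costrength:
  "costrength_of_counit M F (counit_of_costrength M F cst) = cst"
proof (rule extensionalityI[of _ "Obj M \<times> Obj M"])
  fix p assume "p \<in> Obj M \<times> Obj M"
  then obtain A X where p: "p = (A, X)" "A \<in> Obj M" "X \<in> Obj M" by auto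
  show "costrength_of_counit M F (counit_of_costrength M F cst) p = cst p"
    by (rule eq_into_ProdI[of A "FObj F X"])
      (use p in \<open>simp_all add: costrength_of_counit_def endo_simps cst_simps counit_simps
         Pr1_cst Pr2_cst\<close>)
qed (auto simp: costrength_of_counit_def cst_ext)

end

section \<open>From copoints to costrengths\<close>

locale copointed_cartesian = cartesian_endofunctor M F
  for M :: "('o, 'a, 'x) cart_data_scheme" (structure)
    and F :: "('o, 'a, 'o, 'a) functor_data" +
  fixes \<epsilon> :: "'o \<Rightarrow> 'a"
  assumes copointed: "copointed_endofunctor M F \<epsilon>"
begin

lemma eps_simps:
  assumes "X \<in> Obj M"
  shows "\<epsilon> X \<in> Arr M" "Dom M (\<epsilon> X) = FObj F X" "Cod M (\<epsilon> X) = X"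
  using nat_trans.component_hom[OF copointed[unfolded copointed_endofunctor_def] assms] assms
  by (auto simp: hom_def functor_id_def)

text \<open>Oriented to pull arrows out from under \<open>F\<close>; the second clause is the
  right-associated form.\<close>

lemma eps_natural:
  assumes "f \<in> Arr M" and "Cod M f = Y"
  shows "\<epsilon> Y \<cdot> FArr F f = f \<cdot> \<epsilon> (Dom M f)"
    and "h \<in> Arr M \<Longrightarrow> Cod M h = FObj F (Dom M f) \<Longrightarrow> \<epsilon> Y \<cdot> (FArr F f \<cdot> h) = f \<cdot> (\<epsilon> (Dom M f) \<cdot> h)"
proof -
  show *: "\<epsilon> Y \<cdot> FArr F f = f \<cdot> \<epsilon> (Dom M f)"
    using nat_trans.naturality[OF copointed[unfolded copointed_endofunctor_def], of f "Dom M f" Y]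
      assms by (simp add: hom_def functor_id_def)
  show "\<epsilon> Y \<cdot> (FArr F f \<cdot> h) = f \<cdot> (\<epsilon> (Dom M f) \<cdot> h)"
    if "h \<in> Arr M" "Cod M h = FObj F (Dom M f)"
    using that assms * Arr_simps(9)[of h "FArr F f" "\<epsilon> Y"] Arr_simps(9)[of h "\<epsilon> (Dom M f)" f]
    by (auto simp: endo_simps eps_simps)
qed

lemma eps_extensional: "\<epsilon> \<in> extensional (Obj M)"
  using nat_trans.component_ext[OF copointed[unfolded copointed_endofunctor_def]] .

text \<open>Naturality of \<epsilon> along the first projection. This is the form compatible with
  rewriting by \<open>eps_natural\<close>.\<close>

lemma costrength_eq:
  "A \<in> Obj M \<Longrightarrow> X \<in> Obj M \<Longrightarrow> costrength_of_counit M F \<epsilon> (A, X)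
     = tuple M (Pr1 M A X \<cdot> \<epsilon> (Prod M A X)) (FArr F (Pr2 M A X))"
  by (simp add: costrength_of_counit_def endo_simps eps_natural)

text \<open>Naturality and associativity compare tuples: the components through \<epsilon> agree by
  its naturality, those through \<open>F\<close> by functoriality. The unit law reads off the second
  component.\<close>

lemma costrong_costrength: "costrong_endofunctor M F (costrength_of_counit M F \<epsilon>)"
proof
  show "costrength_of_counit M F \<epsilon> \<in> extensional (Obj M \<times> Obj M)"
    by (auto simp: costrength_of_counit_def)
qed (auto simp: hom_def endo_simps eps_simps eps_natural costrength_eq)

text \<open>Projecting leaves \<epsilon> after \<open>F\<close> of the first projection, and that
  projection cancels <id, !>.\<close>

lemma counit_of_costrength_of_counit:
  "counit_of_costrength M F (costrength_of_counit M F \<epsilon>) = \<epsilon>"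
proof (rule extensionalityI[OF _ eps_extensional])
  fix X assume X: "X \<in> Obj M"
  then show "counit_of_costrength M F (costrength_of_counit M F \<epsilon>) X = \<epsilon> X"
    by (simp add: counit_of_costrength_def costrength_of_counit_def endo_simps eps_simps)
qed (auto simp: counit_of_costrength_def)

end

lemma copointed_cartesianI:
  assumes "cartesian_category M" and "copointed_endofunctor M F \<epsilon>"
  shows "copointed_cartesian M F \<epsilon>"
proof -
  interpret cartesian_category M by fact
  interpret nat_trans M M F "functor_id M" \<epsilon>
    using assms(2) by (simp add: copointed_endofunctor_def)
  show ?thesis using assms(2) by unfold_locales
qed

section \<open>Costrong versus copointed transformations\<close>

lemma costrong_nat_trans_iff_copointed:
  assumes "cartesian_category M"
    and "copointed_endofunctor M F \<epsilon>" and "copointed_endofunctor M G \<delta>"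
  shows "costrong_nat_trans M (F, costrength_of_counit M F \<epsilon>) (G, costrength_of_counit M G \<delta>) \<alpha>
    \<longleftrightarrow> copointed_nat_trans M (F, \<epsilon>) (G, \<delta>) \<alpha>"
\<comment> \<open>Both notions include naturality, so both fail when \<alpha> is not
  natural.\<close>
proof (cases "nat_trans M M F G \<alpha>")
  case True
  interpret cartesian_category M by fact
  interpret F: copointed_cartesian M F \<epsilon> by (rule copointed_cartesianI) fact+
  interpret G: copointed_cartesian M G \<delta> by (rule copointed_cartesianI) fact+
  interpret nat_trans M M F G \<alpha> by (rule True)
  have alpha: "\<alpha> X \<in> Arr M" "Dom M (\<alpha> X) = FObj F X" "Cod M (\<alpha> X) = FObj G X" if "X \<in> Obj M" for X
    using component_hom[OF that] by (auto simp: hom_def)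
  have alpha_natural: "FArr G f \<cdot>\<^bsub>M\<^esub> \<alpha> X = \<alpha> (Cod M f) \<cdot>\<^bsub>M\<^esub> FArr F f"
    if "f \<in> Arr M" "Dom M f = X" for f X
    using naturality[of f X "Cod M f"] that by (simp add: hom_def)
  let ?cF = "costrength_of_counit M F \<epsilon>" and ?cG = "costrength_of_counit M G \<delta>"
  have "(\<forall>A\<in>Obj M. \<forall>X\<in>Obj M. ?cG (A, X) \<cdot>\<^bsub>M\<^esub> \<alpha> (Prod M A X)
          = prod_arr M (Id M A) (\<alpha> X) \<cdot>\<^bsub>M\<^esub> ?cF (A, X))
      \<longleftrightarrow> (\<forall>X\<in>Obj M. \<delta> X \<cdot>\<^bsub>M\<^esub> \<alpha> X = \<epsilon> X)" (is "?L \<longleftrightarrow> ?R")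
  proof
    assume L: ?L
    show ?R
    proof
      fix X assume X: "X \<in> Obj M"
      \<comment> \<open>The costrong square is taken at (X, 1), precomposed with \<open>F\<close> of
        this section and projected to X, which turns costrengths into copoints.\<close>
      let ?r = "tuple M (Id M X) (bang M X)"
      have "\<alpha> (Prod M X (One M)) \<cdot>\<^bsub>M\<^esub> FArr F ?r = FArr G ?r \<cdot>\<^bsub>M\<^esub> \<alpha> X"
        using X by (intro naturality) (simp add: hom_def cart_simps)
      then have "\<delta> X \<cdot>\<^bsub>M\<^esub> \<alpha> X = Pr1 M X (FObj G (One M)) \<cdot>\<^bsub>M\<^esub>
          ((?cG (X, One M) \<cdot>\<^bsub>M\<^esub> \<alpha> (Prod M X (One M))) \<cdot>\<^bsub>M\<^esub> FArr F ?r)"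
        using X by (simp add: F.endo_simps G.endo_simps G.eps_simps alpha costrength_of_counit_def)
      also have "\<dots> = Pr1 M X (FObj G (One M)) \<cdot>\<^bsub>M\<^esub>
          ((prod_arr M (Id M X) (\<alpha> (One M)) \<cdot>\<^bsub>M\<^esub> ?cF (X, One M)) \<cdot>\<^bsub>M\<^esub> FArr F ?r)"
        using L X One_in_Obj by simp
      also have "\<dots> = \<epsilon> X"
        using X by (simp add: F.endo_simps G.FObj_simp F.eps_simps alpha costrength_of_counit_def)
      finally show "\<delta> X \<cdot>\<^bsub>M\<^esub> \<alpha> X = \<epsilon> X" .
    qed
  next
    assume R: ?R
    show ?L
    proof (intro ballI)
      fix A X assume AX: "A \<in> Obj M" "X \<in> Obj M"
      \<comment> \<open>The assumption is used at the object A x X for the first components; the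
        second ones agree by naturality of \<alpha> along the second projection.\<close>
      then show "?cG (A, X) \<cdot>\<^bsub>M\<^esub> \<alpha> (Prod M A X) = prod_arr M (Id M A) (\<alpha> X) \<cdot>\<^bsub>M\<^esub> ?cF (A, X)"
        using R by (simp add: F.endo_simps G.FObj_simp G.FArr_simps F.eps_simps G.eps_simps alpha
            alpha_natural F.costrength_eq G.costrength_eq)
    qed
  qed
  \<comment> \<open>Outside \<open>Obj M\<close> both sides are \<open>undefined\<close>, so
    agreement on objects is equality.\<close>
  also have "?R \<longleftrightarrow> nt_comp M M \<delta> \<alpha> = \<epsilon>"
    using F.eps_extensional by (auto simp: nt_comp_def fun_eq_iff extensional_def)
  finally show ?thesis
    using True by (simp add: costrong_nat_trans_def copointed_nat_trans_def)
qed (simp add: costrong_nat_trans_def copointed_nat_trans_def)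

lemma category_copointed:
  "category (structured_category M (copointed_endofunctor M) (copointed_nat_trans M))"
proof (rule category_structured_category)
  fix F s G t \<alpha> assume "copointed_nat_trans M (F, s) (G, t) \<alpha>"
  then show "nat_trans M M F G \<alpha>" by (simp add: copointed_nat_trans_def)
next
  fix F s assume "copointed_endofunctor M F s"
  then interpret nat_trans M M F "functor_id M" s by (simp add: copointed_endofunctor_def)
  show "copointed_nat_trans M (F, s) (F, s) (nt_id M M F)"
    by (simp add: copointed_nat_trans_def F.nat_trans_nt_id nt_Comp_Id)
next
  fix F s G t K u \<alpha> \<beta>
  assume u: "copointed_endofunctor M K u"
    and a: "copointed_nat_trans M (F, s) (G, t) \<alpha>" and b: "copointed_nat_trans M (G, t) (K, u) \<beta>"
  then have nat: "nat_trans M M F G \<alpha>" "nat_trans M M G K \<beta>" "nat_trans M M K (functor_id M) u"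
    by (simp_all add: copointed_nat_trans_def copointed_endofunctor_def)
  show "copointed_nat_trans M (F, s) (K, u) (nt_comp M M \<beta> \<alpha>)"
    using a b nat_trans_nt_comp[OF nat(1,2)] nt_comp_assoc[OF nat]
    by (simp add: copointed_nat_trans_def)
qed

section \<open>Isomorphism of the two categories\<close>

theorem mainTheorem2:
  fixes M :: "('o, 'a) cart_data"
  assumes "cartesian_category M"
  shows "isomorphic_categories (costrong_category M) (copointed_category M)"
proof -
  let ?\<epsilon> = "counit_of_costrength M" and ?cst = "costrength_of_counit M"
  note iff = costrong_nat_trans_iff_copointed[OF assms]
  note to_costrong = copointed_cartesian.costrong_costrength[OF copointed_cartesianI[OF assms]]
  note to_copointed = costrong_endofunctor.copointed_counit
  note round_trip = costrong_endofunctor.costrength_of_counit_of_costrength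
  interpret copointed: category
    "structured_category M (copointed_endofunctor M) (copointed_nat_trans M)"
    by (rule category_copointed)
  \<comment> \<open>Every costrength is recovered from its copoint, so the comparison carries over
    to arbitrary costrengths.\<close>
  have costrong_iff: "costrong_nat_trans M (F, s) (G, t) \<alpha>
      \<longleftrightarrow> copointed_nat_trans M (F, ?\<epsilon> F s) (G, ?\<epsilon> G t) \<alpha>"
    if "costrong_endofunctor M F s" "costrong_endofunctor M G t" for F s G t \<alpha>
    using iff[OF to_copointed[OF that(1)] to_copointed[OF that(2)], of \<alpha>]
    by (simp add: round_trip that)
  \<comment> \<open>Closure under identities and composition is transported from the copointed
    category along \<open>costrong_iff\<close>.\<close>
  have "category (structured_category M (costrong_endofunctor M) (costrong_nat_trans M))"
  proof (rule category_structured_category)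
    fix F s G t \<alpha> assume "costrong_nat_trans M (F, s) (G, t) \<alpha>"
    then show "nat_trans M M F G \<alpha>" by (simp add: costrong_nat_trans_def)
  next
    fix F s assume s: "costrong_endofunctor M F s"
    show "costrong_nat_trans M (F, s) (F, s) (nt_id M M F)"
      using copointed.Id_in_hom[of "(F, ?\<epsilon> F s)"] to_copointed[OF s]
      by (simp add: costrong_iff[OF s s] structured_category_def hom_def)
  next
    fix F s G t K u \<alpha> \<beta>
    assume s: "costrong_endofunctor M F s" and t: "costrong_endofunctor M G t"
      and u: "costrong_endofunctor M K u"
      and "costrong_nat_trans M (F, s) (G, t) \<alpha>" "costrong_nat_trans M (G, t) (K, u) \<beta>"
    then show "costrong_nat_trans M (F, s) (K, u) (nt_comp M M \<beta> \<alpha>)"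
      using copointed.Comp_in_hom[of "((F, ?\<epsilon> F s), (G, ?\<epsilon> G t), \<alpha>)" "(F, ?\<epsilon> F s)" "(G, ?\<epsilon> G t)"
          "((G, ?\<epsilon> G t), (K, ?\<epsilon> K u), \<beta>)" "(K, ?\<epsilon> K u)"]
        to_copointed[OF s] to_copointed[OF t] to_copointed[OF u]
      by (simp add: costrong_iff structured_category_def hom_def)
  qed
  then show ?thesis
    unfolding costrong_category_eq copointed_category_eq
    \<comment> \<open>\<open>?cst\<close> takes the role of \<open>\<psi>\<close> because
      \<open>iff\<close> concerns costrengths built from copoints.\<close>
    by (rule isomorphic_structured_categories[where \<phi> = ?\<epsilon> and \<psi> = ?cst])
      (auto simp: category_copointed to_copointed to_costrong round_trip iff
        copointed_cartesian.counit_of_costrength_of_counit[OF copointed_cartesianI[OF assms]])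
qed

end
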